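(* Let $k\geq 2$ be an integer. Every countable graph, and every countable acyclic digraph, is $(1/k)$-majority $(k+1)$-correspondence colourable: for every assignment of lists $L(v)$ of exactly $k+1$ colours to the vertices and every assignment of bad sets $B_{uv}$ to the edges (arcs) satisfying the correspondence condition, there is a colouring $\chi$ with $\chi(v)\in L(v)$ for all $v$ which is a $(1/k)$-majority correspondence colouring.
   Context: Given a graph $G$, each vertex $v$ has a list $L(v)$ of colours and each edge $uv$ has a set of bad pairs $B_{uv}\subset L(u)\times L(v)$ such that for each $c\in L(u)$ there is at most one pair $(c,c')\in B_{uv}$ and for each $c\in L(v)$ there is at most one pair $(c',c)\in B_{uv}$ (with $B_{vu}$ the corresponding set of reversed pairs). For a digraph, each arc $u\to v$ carries such a set $B_{uv}$. For a colouring $\chi$ with $\chi(v)\in L(v)$, an edge/arc $uv$ is bad if $(\chi(u),\chi(v))\in B_{uv}$. The relevant edges at $v$ are all edges incident with $v$ in the graph case, and the out-arcs of $v$ in the digraph case. $\chi$ is a $(1/k)$-majority correspondence colouring if for every vertex $v$: if $v$ has finitely many relevant edges, at most a $1/k$ proportion of them are bad; if $v$ has infinitely many relevant edges, infinitely many of them are not bad. A graph/digraph is $(1/k)$-majority $\ell$-correspondence colourable if for every such system of lists of size $\ell$ and bad sets there is a $(1/k)$-majority correspondence colouring. An acyclic digraph has no directed cycle. *)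

theory Defs
  imports Complex_Main "HOL-Library.Countable_Set"
begin

text \<open>
  A simple graph is a symmetric irreflexive relation \<open>E\<close> on \<open>V\<close>: the edge \<open>uv\<close> is represented by
  the two pairs \<open>(u, v)\<close> and \<open>(v, u)\<close>. A digraph is an arbitrary relation on \<open>V\<close>, where \<open>(u, v)\<close>
  is the arc from \<open>u\<close> to \<open>v\<close>.
\<close>

definition graph :: "'v set \<Rightarrow> 'v rel \<Rightarrow> bool" where
  "graph V E \<longleftrightarrow> E \<subseteq> V \<times> V \<and> sym E \<and> irrefl E"

definition digraph :: "'v set \<Rightarrow> 'v rel \<Rightarrow> bool" where
  "digraph V E \<longleftrightarrow> E \<subseteq> V \<times> V"

definition correspondence :: "'c set \<Rightarrow> 'c set \<Rightarrow> ('c \<times> 'c) set \<Rightarrow> bool" where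
  "correspondence X Y M \<longleftrightarrow> M \<subseteq> X \<times> Y \<and>
     (\<forall>c\<in>X. \<exists>\<^sub>\<le>\<^sub>1 c'. (c, c') \<in> M) \<and> (\<forall>c\<in>Y. \<exists>\<^sub>\<le>\<^sub>1 c'. (c', c) \<in> M)"

definition digraph_system ::
  "nat \<Rightarrow> 'v set \<Rightarrow> 'v rel \<Rightarrow> ('v \<Rightarrow> 'c set) \<Rightarrow> ('v \<Rightarrow> 'v \<Rightarrow> ('c \<times> 'c) set) \<Rightarrow> bool" where
  "digraph_system l V E L B \<longleftrightarrow>
     (\<forall>v\<in>V. finite (L v) \<and> card (L v) = l) \<and>
     (\<forall>(u, v)\<in>E. correspondence (L u) (L v) (B u v))"

definition graph_system ::
  "nat \<Rightarrow> 'v set \<Rightarrow> 'v rel \<Rightarrow> ('v \<Rightarrow> 'c set) \<Rightarrow> ('v \<Rightarrow> 'v \<Rightarrow> ('c \<times> 'c) set) \<Rightarrow> bool" where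
  "graph_system l V E L B \<longleftrightarrow>
     digraph_system l V E L B \<and> (\<forall>(u, v)\<in>E. B v u = (B u v)\<inverse>)"

text \<open>
  For a digraph these are the out-arcs of \<open>v\<close>. For a graph they are all the edges incident with \<open>v\<close>,
  each represented exactly once, by the pair whose first component is \<open>v\<close>.
\<close>

definition relevant_edges :: "'v rel \<Rightarrow> 'v \<Rightarrow> ('v \<times> 'v) set" where
  "relevant_edges E v = {e \<in> E. fst e = v}"

definition bad :: "('v \<Rightarrow> 'v \<Rightarrow> ('c \<times> 'c) set) \<Rightarrow> ('v \<Rightarrow> 'c) \<Rightarrow> 'v \<times> 'v \<Rightarrow> bool" where
  "bad B \<chi> = (\<lambda>(u, v). (\<chi> u, \<chi> v) \<in> B u v)"

definition majority_correspondence_colouring ::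
  "nat \<Rightarrow> 'v set \<Rightarrow> 'v rel \<Rightarrow> ('v \<Rightarrow> 'c set) \<Rightarrow> ('v \<Rightarrow> 'v \<Rightarrow> ('c \<times> 'c) set) \<Rightarrow> ('v \<Rightarrow> 'c) \<Rightarrow> bool" where
  "majority_correspondence_colouring k V E L B \<chi> \<longleftrightarrow>
     (\<forall>v\<in>V. \<chi> v \<in> L v) \<and>
     (\<forall>v\<in>V.
        if finite (relevant_edges E v)
        then real (card {e \<in> relevant_edges E v. bad B \<chi> e})
               \<le> 1 / real k * real (card (relevant_edges E v))
        else infinite {e \<in> relevant_edges E v. \<not> bad B \<chi> e})"

text \<open>The argument of type \<open>'c itself\<close> only fixes the type the colours are taken from.\<close>

definition graph_majority_correspondence_colourable ::
  "'c itself \<Rightarrow> nat \<Rightarrow> nat \<Rightarrow> 'v set \<Rightarrow> 'v rel \<Rightarrow> bool" where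
  "graph_majority_correspondence_colourable _ k l V E \<longleftrightarrow>
     (\<forall>(L :: 'v \<Rightarrow> 'c set) B. graph_system l V E L B \<longrightarrow>
        (\<exists>\<chi>. majority_correspondence_colouring k V E L B \<chi>))"

definition digraph_majority_correspondence_colourable ::
  "'c itself \<Rightarrow> nat \<Rightarrow> nat \<Rightarrow> 'v set \<Rightarrow> 'v rel \<Rightarrow> bool" where
  "digraph_majority_correspondence_colourable _ k l V E \<longleftrightarrow>
     (\<forall>(L :: 'v \<Rightarrow> 'c set) B. digraph_system l V E L B \<longrightarrow>
        (\<exists>\<chi>. majority_correspondence_colouring k V E L B \<chi>))"

end

theory Submission
  imports Defs "HOL-Analysis.Function_Topology"
begin

text \<open>
  Delete one colour from every list so that, whatever colour \<open>c\<close> a vertex \<open>v\<close> with infinitely many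
  relevant edges receives, infinitely many of its neighbours have lost their unique colour in
  conflict with \<open>c\<close>. This is possible since there are only countably many pairs \<open>(v, c)\<close> to serve,
  so that they can be served on pairwise disjoint infinite sets of neighbours.
  Vertices with infinitely many relevant edges are then satisfied by every colouring from the
  remaining lists, which still have \<open>k\<close> colours. For finitely many vertices with finitely many
  relevant edges, averaging over \<open>k\<close> colours recolours any single vertex well: in a graph, a
  colouring with the fewest bad edges works, and in an acyclic digraph one colours each vertex after
  its out-neighbours. Compactness of the product of the lists concludes.
\<close>

lemma countable_infinite_sets_distinct_representatives:
  assumes "countable I" and inf: "\<And>i. i \<in> I \<Longrightarrow> infinite (N i)"
  obtains h where "inj_on h I" "\<And>i. i \<in> I \<Longrightarrow> h i \<in> N i"
proof (cases "I = {}")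
  case False
  have "\<exists>f. \<forall>n. f n \<in> N (from_nat_into I n) - f ` {..<n}"
  proof (rule dependent_wellorder_choice)
    show "r \<in> N (from_nat_into I n) - f ` {..<n} \<longleftrightarrow> r \<in> N (from_nat_into I n) - g ` {..<n}"
      if "\<And>m. m < n \<Longrightarrow> f m = g m" for r f g and n :: nat
      using that by (auto simp: image_iff)
    show "\<exists>r. r \<in> N (from_nat_into I n) - f ` {..<n}" for n and f :: "nat \<Rightarrow> 'b"
    proof -
      have "infinite (N (from_nat_into I n) - f ` {..<n})"
        using inf from_nat_into[OF False] by (intro Diff_infinite_finite) auto
      then show ?thesis
        using infinite_imp_nonempty by blast
    qed
  qed
  then obtain f where f: "\<And>n. f n \<in> N (from_nat_into I n)" "\<And>n m. m < n \<Longrightarrow> f n \<noteq> f m"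
    by blast
  have "inj f"
    by (rule injI) (metis f(2) linorder_neqE_nat)
  then have "inj_on (\<lambda>i. f (to_nat_on I i)) I"
    using \<open>countable I\<close> by (intro inj_onI) (simp add: inj_eq)
  moreover have "f (to_nat_on I i) \<in> N i" if "i \<in> I" for i
    using f(1)[of "to_nat_on I i"] that \<open>countable I\<close> by simp
  ultimately show thesis
    by (rule that)
qed (use that in auto)

lemma countable_infinite_sets_disjoint_infinite_subsets:
  assumes "countable I" and inf: "\<And>i. i \<in> I \<Longrightarrow> infinite (N i)"
  obtains M where "disjoint_family_on M I" "\<And>i. i \<in> I \<Longrightarrow> infinite (M i)"
    "\<And>i. i \<in> I \<Longrightarrow> M i \<subseteq> N i"
proof -
  have "countable (I \<times> (UNIV :: nat set))"
    using \<open>countable I\<close> by simp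
  moreover have "infinite (N (fst p))" if "p \<in> I \<times> (UNIV :: nat set)" for p
    using inf that by auto
  ultimately obtain h :: "'a \<times> nat \<Rightarrow> 'b" where h: "inj_on h (I \<times> UNIV)"
    "\<And>p. p \<in> I \<times> UNIV \<Longrightarrow> h p \<in> N (fst p)"
    using countable_infinite_sets_distinct_representatives[of "I \<times> UNIV" "\<lambda>p. N (fst p)"] by blast
  define M where "M i = range (\<lambda>n. h (i, n))" for i
  show thesis
  proof
    show "disjoint_family_on M I"
      using h(1) by (auto simp: M_def disjoint_family_on_def inj_on_def)
    show "infinite (M i)" if "i \<in> I" for i
      unfolding M_def using h(1) that by (intro range_inj_infinite) (auto simp: inj_on_def)
    show "M i \<subseteq> N i" if "i \<in> I" for i
      using h(2) that by (force simp: M_def)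
  qed
qed

lemma countable_infinitely_often_prescribed_values:
  fixes g :: "'t \<Rightarrow> 'v \<Rightarrow> 'c"
  assumes "countable T" and "\<And>t. t \<in> T \<Longrightarrow> infinite (N t)"
  obtains d where "\<And>t. t \<in> T \<Longrightarrow> infinite {u \<in> N t. d u = g t u}"
proof -
  obtain M where M: "disjoint_family_on M T" "\<And>t. t \<in> T \<Longrightarrow> infinite (M t)"
    "\<And>t. t \<in> T \<Longrightarrow> M t \<subseteq> N t"
    using countable_infinite_sets_disjoint_infinite_subsets[of T N, OF assms] by blast
  define d where "d u = g (THE t. t \<in> T \<and> u \<in> M t) u" for u
  have "infinite {u \<in> N t. d u = g t u}" if "t \<in> T" for t
  proof -
    have "(THE t'. t' \<in> T \<and> u \<in> M t') = t" if "u \<in> M t" for u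
      using that \<open>t \<in> T\<close> M(1) by (intro the_equality) (auto simp: disjoint_family_on_def)
    then have "M t \<subseteq> {u \<in> N t. d u = g t u}"
      using M(3)[OF \<open>t \<in> T\<close>] by (auto simp: d_def)
    then show ?thesis
      using M(2)[OF that] finite_subset by blast
  qed
  then show thesis
    by (rule that)
qed

lemma openin_product_discrete_finitely_determined:
  assumes "finite D"
    and determined: "\<And>\<chi> \<chi>'. (\<And>u. u \<in> D \<Longrightarrow> \<chi> u = \<chi>' u) \<Longrightarrow> P \<chi> \<Longrightarrow> P \<chi>'"
  shows "openin (product_topology (\<lambda>v. discrete_topology (L v)) V) {\<chi> \<in> Pi\<^sub>E V L. P \<chi>}"
  unfolding openin_product_topology_alt
proof
  fix \<chi> assume \<chi>: "\<chi> \<in> {\<chi> \<in> Pi\<^sub>E V L. P \<chi>}"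
  define U where "U v = (if v \<in> D then {\<chi> v} else L v)" for v
  have "finite {v \<in> V. U v \<noteq> L v}"
    by (rule finite_subset[OF _ \<open>finite D\<close>]) (auto simp: U_def)
  moreover have "U v \<subseteq> L v" if "v \<in> V" for v
    using \<chi> that by (auto simp: U_def)
  moreover have "\<chi> \<in> Pi\<^sub>E V U"
    using \<chi> by (auto simp: U_def PiE_iff)
  moreover have "P \<chi>'" if "\<chi>' \<in> Pi\<^sub>E V U" for \<chi>'
  proof (rule determined)
    show "\<chi> u = \<chi>' u" if "u \<in> D" for u
      using \<open>\<chi>' \<in> Pi\<^sub>E V U\<close> \<chi> that by (cases "u \<in> V") (auto simp: U_def PiE_iff extensional_def)
  qed (use \<chi> in auto)
  ultimately show "\<exists>U. finite {v \<in> V. U v \<noteq> topspace (discrete_topology (L v))} \<and>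
      (\<forall>v\<in>V. openin (discrete_topology (L v)) (U v)) \<and> \<chi> \<in> Pi\<^sub>E V U \<and>
      Pi\<^sub>E V U \<subseteq> {\<chi> \<in> Pi\<^sub>E V L. P \<chi>}"
    by (intro exI[of _ U]) (auto simp: PiE_iff)
qed

lemma closedin_product_discrete_finitely_determined:
  assumes "finite D"
    and determined: "\<And>\<chi> \<chi>'. (\<And>u. u \<in> D \<Longrightarrow> \<chi> u = \<chi>' u) \<Longrightarrow> P \<chi> \<Longrightarrow> P \<chi>'"
  shows "closedin (product_topology (\<lambda>v. discrete_topology (L v)) V) {\<chi> \<in> Pi\<^sub>E V L. P \<chi>}"
proof -
  have "openin (product_topology (\<lambda>v. discrete_topology (L v)) V) {\<chi> \<in> Pi\<^sub>E V L. \<not> P \<chi>}"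
    using \<open>finite D\<close> by (rule openin_product_discrete_finitely_determined) (metis determined)
  moreover have "Pi\<^sub>E V L - {\<chi> \<in> Pi\<^sub>E V L. P \<chi>} = {\<chi> \<in> Pi\<^sub>E V L. \<not> P \<chi>}"
    by blast
  ultimately show ?thesis
    by (simp add: closedin_def)
qed

lemma finite_choices_compactness:
  assumes fin: "\<And>v. v \<in> V \<Longrightarrow> finite (L v)"
    and D: "\<And>i. i \<in> S \<Longrightarrow> finite (D i)" "\<And>i. i \<in> S \<Longrightarrow> D i \<subseteq> V"
    and determined:
      "\<And>i \<chi> \<chi>'. i \<in> S \<Longrightarrow> (\<And>u. u \<in> D i \<Longrightarrow> \<chi> u = \<chi>' u) \<Longrightarrow> P i \<chi> \<Longrightarrow> P i \<chi>'"
    and fin_sat: "\<And>F. finite F \<Longrightarrow> F \<subseteq> S \<Longrightarrow> \<exists>\<chi>\<in>Pi V L. \<forall>i\<in>F. P i \<chi>"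
  shows "\<exists>\<chi>\<in>Pi V L. \<forall>i\<in>S. P i \<chi>"
proof -
  let ?X = "product_topology (\<lambda>v. discrete_topology (L v)) V"
  define C where "C i = {\<chi> \<in> Pi\<^sub>E V L. P i \<chi>}" for i
  have compact: "compactin ?X (Pi\<^sub>E V L)"
    using fin compact_space_product_topology[of "\<lambda>v. discrete_topology (L v)" V]
    by (simp add: compact_space_def compactin_discrete_topology)
  have closed: "closedin ?X (C i)" if "i \<in> S" for i
    unfolding C_def using D(1)[OF that] determined[OF that]
    by (rule closedin_product_discrete_finitely_determined)
  have "Pi\<^sub>E V L \<inter> \<Inter> (C ` S) \<noteq> {}"
  proof (rule compactin_fip[THEN iffD1, OF compact, THEN conjunct2, rule_format],
      intro conjI ballI allI impI)
    show "closedin ?X K" if "K \<in> C ` S" for K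
      using closed that by blast
    fix \<F> assume "finite \<F> \<and> \<F> \<subseteq> C ` S"
    then obtain F where F: "finite F" "F \<subseteq> S" "\<F> = C ` F"
      using finite_subset_image[of \<F> C S] by blast
    obtain \<chi> where \<chi>: "\<chi> \<in> Pi V L" "\<And>i. i \<in> F \<Longrightarrow> P i \<chi>"
      using fin_sat[OF F(1,2)] by blast
    have "P i (restrict \<chi> V)" if "i \<in> F" for i
      using determined[of i \<chi> "restrict \<chi> V"] \<chi>(2)[OF that] D(2) F(2) that
      by (auto simp: subset_iff)
    then have "restrict \<chi> V \<in> Pi\<^sub>E V L \<inter> \<Inter> \<F>"
      using \<chi>(1) F(3) by (auto simp: C_def)
    then show "Pi\<^sub>E V L \<inter> \<Inter> \<F> \<noteq> {}"
      by blast
  qed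
  then show ?thesis
    by (auto simp: C_def PiE_iff Pi_iff)
qed

lemma exists_colour_few_conflicts:
  assumes "finite N" "k \<le> card A" "0 < k"
    and unique: "\<And>x c c'. x \<in> N \<Longrightarrow> c \<in> A \<Longrightarrow> c' \<in> A \<Longrightarrow> R c x \<Longrightarrow> R c' x \<Longrightarrow> c = c'"
  shows "\<exists>c\<in>A. k * card {x \<in> N. R c x} \<le> card N"
proof (rule ccontr)
  assume "\<not> ?thesis"
  then have "card N + 1 \<le> k * card {x \<in> N. R c x}" if "c \<in> A" for c
    using that by force
  then have "(\<Sum>c\<in>A. card N + 1) \<le> (\<Sum>c\<in>A. k * card {x \<in> N. R c x})"
    by (rule sum_mono)
  also have "\<dots> = k * (\<Sum>c\<in>A. card {x \<in> N. R c x})"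
    by (rule sum_distrib_left[symmetric])
  also have "(\<Sum>c\<in>A. card {x \<in> N. R c x}) = card (\<Union>c\<in>A. {x \<in> N. R c x})"
    using assms(1-3) unique by (subst card_UN_disjoint) (auto intro: card_ge_0_finite)
  also have "k * \<dots> \<le> k * card N"
    using \<open>finite N\<close> by (intro mult_left_mono card_mono) auto
  also have "\<dots> < k * (card N + 1)"
    using \<open>0 < k\<close> by simp
  also have "\<dots> \<le> (\<Sum>c\<in>A. card N + 1)"
    using \<open>k \<le> card A\<close> by (simp only: sum_constant of_nat_id mult_le_mono1)
  finally show False
    by simp
qed

lemma relevant_edges_eq_Pair_image: "relevant_edges E v = Pair v ` (E `` {v})"
  by (auto simp: relevant_edges_def)

lemma finite_relevant_edges_iff: "finite (relevant_edges E v) \<longleftrightarrow> finite (E `` {v})"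
  by (simp add: relevant_edges_eq_Pair_image finite_image_iff inj_on_def)

definition edgewise_correspondence ::
  "'v rel \<Rightarrow> ('v \<Rightarrow> 'c set) \<Rightarrow> ('v \<Rightarrow> 'v \<Rightarrow> ('c \<times> 'c) set) \<Rightarrow> bool" where
  "edgewise_correspondence E L B \<longleftrightarrow> (\<forall>(u, v)\<in>E. correspondence (L u) (L v) (B u v))"

lemma edgewise_correspondence_left_unique:
  assumes "edgewise_correspondence E L B" "(u, v) \<in> E" "(c, d) \<in> B u v" "(c', d) \<in> B u v"
  shows "c = c'"
  using assms unfolding edgewise_correspondence_def correspondence_def Uniq_def by blast

lemma edgewise_correspondence_right_unique:
  assumes "edgewise_correspondence E L B" "(u, v) \<in> E" "(c, d) \<in> B u v" "(c, d') \<in> B u v"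
  shows "d = d'"
  using assms unfolding edgewise_correspondence_def correspondence_def Uniq_def by blast

lemma exists_deletion_serving_infinite_degrees:
  fixes L :: "'v \<Rightarrow> 'c set"
  assumes "countable V" "\<And>v. v \<in> V \<Longrightarrow> countable (L v)" and corr: "edgewise_correspondence E L B"
  obtains d where "\<And>v c. v \<in> V \<Longrightarrow> infinite (E `` {v}) \<Longrightarrow> c \<in> L v \<Longrightarrow>
    infinite {u \<in> E `` {v}. \<forall>c'\<in>L u - {d u}. (c, c') \<notin> B v u}"
proof -
  define T where "T = (SIGMA v:{v \<in> V. infinite (E `` {v})}. L v)"
  define conflict where "conflict = (\<lambda>(v, c) u. SOME c'. (c, c') \<in> B v u)"
  have "countable T"
    unfolding T_def using assms(1,2) by (intro countable_SIGMA) auto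
  moreover have "infinite (E `` {fst t})" if "t \<in> T" for t
    using that by (auto simp: T_def)
  ultimately obtain d :: "'v \<Rightarrow> 'c"
    where d: "\<And>t. t \<in> T \<Longrightarrow> infinite {u \<in> E `` {fst t}. d u = conflict t u}"
    using countable_infinitely_often_prescribed_values[of T "\<lambda>t. E `` {fst t}" conflict] by blast
  show thesis
  proof
    fix v c assume "v \<in> V" "infinite (E `` {v})" "c \<in> L v"
    then have "infinite {u \<in> E `` {v}. d u = conflict (v, c) u}"
      using d[of "(v, c)"] by (simp add: T_def)
    moreover have "c' = conflict (v, c) u" if "(v, u) \<in> E" "(c, c') \<in> B v u" for u c'
    proof (rule edgewise_correspondence_right_unique[OF corr that])
      show "(c, conflict (v, c) u) \<in> B v u"
        unfolding conflict_def prod.case using that(2) by (rule someI)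
    qed
    then have "{u \<in> E `` {v}. d u = conflict (v, c) u}
        \<subseteq> {u \<in> E `` {v}. \<forall>c'\<in>L u - {d u}. (c, c') \<notin> B v u}"
      by auto
    ultimately show "infinite {u \<in> E `` {v}. \<forall>c'\<in>L u - {d u}. (c, c') \<notin> B v u}"
      using finite_subset by blast
  qed
qed

definition bad_edges ::
  "'v rel \<Rightarrow> ('v \<Rightarrow> 'v \<Rightarrow> ('c \<times> 'c) set) \<Rightarrow> ('v \<Rightarrow> 'c) \<Rightarrow> 'v rel" where
  "bad_edges E B \<chi> = {e \<in> E. bad B \<chi> e}"

lemma relevant_bad_edges:
  "relevant_edges (bad_edges E B \<chi>) v = {e \<in> relevant_edges E v. bad B \<chi> e}"
  by (auto simp: relevant_edges_def bad_edges_def)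

definition few_bad_edges ::
  "nat \<Rightarrow> 'v rel \<Rightarrow> ('v \<Rightarrow> 'v \<Rightarrow> ('c \<times> 'c) set) \<Rightarrow> ('v \<Rightarrow> 'c) \<Rightarrow> 'v \<Rightarrow> bool" where
  "few_bad_edges k E B \<chi> v \<longleftrightarrow>
     k * card (relevant_edges (bad_edges E B \<chi>) v) \<le> card (relevant_edges E v)"

lemma few_bad_edges_iff_proportion:
  assumes "0 < k"
  shows "few_bad_edges k E B \<chi> v \<longleftrightarrow>
    real (card {e \<in> relevant_edges E v. bad B \<chi> e}) \<le> 1 / real k * real (card (relevant_edges E v))"
    (is "_ \<longleftrightarrow> real ?bad \<le> 1 / real k * real ?all")
proof -
  have "few_bad_edges k E B \<chi> v \<longleftrightarrow> real k * real ?bad \<le> real ?all"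
    unfolding few_bad_edges_def relevant_bad_edges by (simp flip: of_nat_mult)
  also have "\<dots> \<longleftrightarrow> real ?bad \<le> 1 / real k * real ?all"
    using assms by (simp add: field_simps)
  finally show ?thesis .
qed

lemma few_bad_edges_cong:
  assumes "\<And>u. u \<in> insert v (E `` {v}) \<Longrightarrow> \<chi> u = \<chi>' u"
  shows "few_bad_edges k E B \<chi> v \<longleftrightarrow> few_bad_edges k E B \<chi>' v"
proof -
  have "relevant_edges (bad_edges E B \<chi>) v = relevant_edges (bad_edges E B \<chi>') v"
    using assms by (auto simp: relevant_edges_def bad_edges_def bad_def)
  then show ?thesis
    by (simp add: few_bad_edges_def)
qed

lemma exists_recolouring_few_bad_edges:
  assumes corr: "edgewise_correspondence E L B" and "(v, v) \<notin> E" "finite (E `` {v})"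
    and "k \<le> card A" "0 < k"
  shows "\<exists>c\<in>A. few_bad_edges k E B (\<chi>(v := c)) v"
  unfolding few_bad_edges_def relevant_bad_edges
proof (rule exists_colour_few_conflicts)
  fix e c c'
  assume e: "e \<in> relevant_edges E v" "bad B (\<chi>(v := c)) e" "bad B (\<chi>(v := c')) e"
  then obtain u where u: "e = (v, u)" "(v, u) \<in> E"
    by (auto simp: relevant_edges_eq_Pair_image)
  with e \<open>(v, v) \<notin> E\<close> have "(c, \<chi> u) \<in> B v u" "(c', \<chi> u) \<in> B v u"
    by (auto simp: bad_def split: if_splits)
  then show "c = c'"
    by (rule edgewise_correspondence_left_unique[OF corr u(2)])
qed (use assms in \<open>auto simp: finite_relevant_edges_iff\<close>)

text \<open>
  The lists \<open>L\<close> are unrelated to those between which \<open>B\<close> is a correspondence; the latter lose a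
  colour before the vertices are coloured.
\<close>

definition finitely_majority_choosable ::
  "nat \<Rightarrow> 'v set \<Rightarrow> 'v rel \<Rightarrow> ('v \<Rightarrow> 'v \<Rightarrow> ('c \<times> 'c) set) \<Rightarrow> bool" where
  "finitely_majority_choosable k V E B \<longleftrightarrow>
     (\<forall>(L :: 'v \<Rightarrow> 'c set) F. (\<forall>v\<in>V. k \<le> card (L v)) \<longrightarrow> finite F \<longrightarrow>
        F \<subseteq> {v \<in> V. finite (E `` {v})} \<longrightarrow> (\<exists>\<chi>\<in>Pi V L. \<forall>v\<in>F. few_bad_edges k E B \<chi> v))"

lemma finite_acyclic_obtains_source:
  assumes "acyclic E" "finite F" "F \<noteq> {}"
  obtains v where "v \<in> F" "\<And>u. u \<in> F \<Longrightarrow> (u, v) \<notin> E"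
proof -
  have "wf (Restr E F)"
    using assms(1,2) by (intro finite_acyclic_wf) (auto intro: acyclic_subset)
  moreover obtain w where "w \<in> F"
    using \<open>F \<noteq> {}\<close> by blast
  ultimately obtain v where "v \<in> F" "\<And>u. (u, v) \<in> Restr E F \<Longrightarrow> u \<notin> F"
    by (rule wfE_min) blast
  then show thesis
    using that by blast
qed

lemma acyclic_finitely_majority_choosable:
  fixes B :: "'v \<Rightarrow> 'v \<Rightarrow> ('c \<times> 'c) set"
  assumes corr: "edgewise_correspondence E L\<^sub>0 B" and "acyclic E" "0 < k"
  shows "finitely_majority_choosable k V E B"
  unfolding finitely_majority_choosable_def
proof (intro allI impI)
  fix L :: "'v \<Rightarrow> 'c set" and F
  assume card_L: "\<forall>v\<in>V. k \<le> card (L v)"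
    and "finite F" "F \<subseteq> {v \<in> V. finite (E `` {v})}"
  from this(2,3) show "\<exists>\<chi>\<in>Pi V L. \<forall>v\<in>F. few_bad_edges k E B \<chi> v"
  proof (induction F rule: finite_psubset_induct)
    case (psubset F)
    show ?case
    proof (cases "F = {}")
      case True
      have "Pi V L \<noteq> {}"
        using card_L \<open>0 < k\<close> by fastforce
      with True show ?thesis
        by blast
    next
      case False
      then obtain v where v: "v \<in> F" "\<And>u. u \<in> F \<Longrightarrow> (u, v) \<notin> E"
        using finite_acyclic_obtains_source[OF \<open>acyclic E\<close> \<open>finite F\<close>] by blast
      then obtain \<chi> where \<chi>: "\<chi> \<in> Pi V L" "\<And>u. u \<in> F - {v} \<Longrightarrow> few_bad_edges k E B \<chi> u"
        using psubset.IH[of "F - {v}"] psubset.prems by blast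
      obtain c where c: "c \<in> L v" "few_bad_edges k E B (\<chi>(v := c)) v"
        using exists_recolouring_few_bad_edges[OF corr] v psubset.prems card_L \<open>0 < k\<close> by blast
      have "few_bad_edges k E B (\<chi>(v := c)) u \<longleftrightarrow> few_bad_edges k E B \<chi> u" if "u \<in> F - {v}" for u
        by (rule few_bad_edges_cong) (use v(2) that in auto)
      then have "few_bad_edges k E B (\<chi>(v := c)) u" if "u \<in> F - {v}" for u
        using \<chi>(2) that by blast
      moreover have "\<chi>(v := c) \<in> Pi V L"
        using \<chi>(1) c(1) by auto
      ultimately show ?thesis
        using c(2) by blast
    qed
  qed
qed

lemma card_sym_irrefl_rel:
  assumes "finite R" "sym R" "irrefl R"
  shows "card R = 2 * card (relevant_edges R v) + card {e \<in> R. fst e \<noteq> v \<and> snd e \<noteq> v}"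
proof -
  let ?A = "relevant_edges R v" and ?C = "{e \<in> R. fst e \<noteq> v \<and> snd e \<noteq> v}"
  have fin: "finite ?A" "finite ?C"
    using \<open>finite R\<close> by (auto simp: relevant_edges_def)
  have "R = ?A \<union> ?A\<inverse> \<union> ?C"
    using \<open>sym R\<close> by (auto simp: relevant_edges_def dest: symD)
  then have "card R = card (?A \<union> ?A\<inverse> \<union> ?C)"
    by simp
  also have "\<dots> = card (?A \<union> ?A\<inverse>) + card ?C"
    using fin by (intro card_Un_disjoint) (auto simp: relevant_edges_def)
  also have "card (?A \<union> ?A\<inverse>) = card ?A + card (?A\<inverse>)"
    using fin \<open>irrefl R\<close>
    by (intro card_Un_disjoint) (auto simp: relevant_edges_def irrefl_def)
  finally show ?thesis
    by simp
qed

lemma card_bad_edges_recolour_le_iff: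
  assumes "finite E" "sym E" "irrefl E" and B: "\<forall>(u, w)\<in>E. B w u = (B u w)\<inverse>"
  shows "card (bad_edges E B \<chi>) \<le> card (bad_edges E B (\<chi>(v := c))) \<longleftrightarrow>
    card (relevant_edges (bad_edges E B \<chi>) v)
      \<le> card (relevant_edges (bad_edges E B (\<chi>(v := c))) v)"
proof -
  have "finite (bad_edges E B \<psi>)" "sym (bad_edges E B \<psi>)" "irrefl (bad_edges E B \<psi>)" for \<psi>
    using assms by (auto simp: bad_edges_def bad_def sym_def irrefl_def)
  note card_split = card_sym_irrefl_rel[OF this, of _ v]
  have "{e \<in> bad_edges E B (\<chi>(v := c)). fst e \<noteq> v \<and> snd e \<noteq> v} =
      {e \<in> bad_edges E B \<chi>. fst e \<noteq> v \<and> snd e \<noteq> v}"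
    by (auto simp: bad_edges_def bad_def)
  then show ?thesis
    using card_split[of \<chi>] card_split[of "\<chi>(v := c)"] by simp
qed

lemma finite_sym_rel_meeting:
  assumes "sym R" "finite F" "\<And>v. v \<in> F \<Longrightarrow> finite (R `` {v})"
  shows "finite (R \<inter> (F \<times> UNIV \<union> UNIV \<times> F))"
proof (rule finite_subset)
  show "R \<inter> (F \<times> UNIV \<union> UNIV \<times> F)
      \<subseteq> (\<Union>v\<in>F. relevant_edges R v) \<union> (\<Union>v\<in>F. relevant_edges R v)\<inverse>"
    using \<open>sym R\<close> by (auto simp: relevant_edges_def dest: symD)
qed (use assms(2,3) in \<open>auto simp: finite_relevant_edges_iff\<close>)

lemma graph_finitely_majority_choosable:
  fixes B :: "'v \<Rightarrow> 'v \<Rightarrow> ('c \<times> 'c) set"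
  assumes corr: "edgewise_correspondence E L\<^sub>0 B" and "sym E" "irrefl E"
    and B: "\<forall>(u, v)\<in>E. B v u = (B u v)\<inverse>" and "0 < k"
  shows "finitely_majority_choosable k V E B"
  unfolding finitely_majority_choosable_def
proof (intro allI impI)
  fix L :: "'v \<Rightarrow> 'c set" and F
  assume card_L: "\<forall>v\<in>V. k \<le> card (L v)"
    and "finite F" and F: "F \<subseteq> {v \<in> V. finite (E `` {v})}"
  define X where "X = E \<inter> (F \<times> UNIV \<union> UNIV \<times> F)"
  have "finite X"
    unfolding X_def using \<open>sym E\<close> \<open>finite F\<close> F by (intro finite_sym_rel_meeting) auto
  have X: "sym X" "irrefl X" "\<forall>(u, v)\<in>X. B v u = (B u v)\<inverse>"
    using \<open>sym E\<close> \<open>irrefl E\<close> B by (auto simp: X_def sym_def irrefl_def)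
  have relevant_X: "relevant_edges (bad_edges X B \<chi>) v = relevant_edges (bad_edges E B \<chi>) v"
    if "v \<in> F" for \<chi> v
    using that by (auto simp: X_def relevant_edges_def bad_edges_def)
  have "Pi V L \<noteq> {}"
    using card_L \<open>0 < k\<close> by fastforce
  then obtain \<chi> where \<chi>: "\<chi> \<in> Pi V L"
    "\<And>\<psi>. \<psi> \<in> Pi V L \<Longrightarrow> card (bad_edges X B \<chi>) \<le> card (bad_edges X B \<psi>)"
    using ex_has_least_nat[of "\<lambda>\<chi>. \<chi> \<in> Pi V L" _ "\<lambda>\<chi>. card (bad_edges X B \<chi>)"] by blast
  have "few_bad_edges k E B \<chi> v" if v: "v \<in> F" for v
  proof -
    obtain c where c: "c \<in> L v" "few_bad_edges k E B (\<chi>(v := c)) v"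
      using exists_recolouring_few_bad_edges[OF corr, of v k "L v" \<chi>] \<open>irrefl E\<close> v F card_L
        \<open>0 < k\<close>
      unfolding irrefl_def by blast
    have "card (bad_edges X B \<chi>) \<le> card (bad_edges X B (\<chi>(v := c)))"
      using \<chi>(1) c(1) by (intro \<chi>(2)) auto
    then have "card (relevant_edges (bad_edges E B \<chi>) v)
        \<le> card (relevant_edges (bad_edges E B (\<chi>(v := c))) v)"
      unfolding card_bad_edges_recolour_le_iff[OF \<open>finite X\<close> X] relevant_X[OF v] .
    then show ?thesis
      using c(2) unfolding few_bad_edges_def by (meson le_trans mult_le_mono2)
  qed
  with \<chi>(1) show "\<exists>\<chi>\<in>Pi V L. \<forall>v\<in>F. few_bad_edges k E B \<chi> v"
    by blast
qed

lemma finitely_majority_choosable_imp_choosable: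
  assumes "finitely_majority_choosable k V E B" "E \<subseteq> V \<times> V"
    and card_L: "\<And>v. v \<in> V \<Longrightarrow> k \<le> card (L v)" and "0 < k"
  obtains \<chi> where "\<chi> \<in> Pi V L" "\<And>v. v \<in> V \<Longrightarrow> finite (E `` {v}) \<Longrightarrow> few_bad_edges k E B \<chi> v"
proof -
  let ?S = "{v \<in> V. finite (E `` {v})}"
  have "\<exists>\<chi>\<in>Pi V L. \<forall>v\<in>?S. few_bad_edges k E B \<chi> v"
  proof (rule finite_choices_compactness[where D = "\<lambda>v. insert v (E `` {v})"])
    show "finite (L v)" if "v \<in> V" for v
      using card_L[OF that] \<open>0 < k\<close> by (intro card_ge_0_finite) simp
    show "few_bad_edges k E B \<chi>' v"
      if "\<And>u. u \<in> insert v (E `` {v}) \<Longrightarrow> \<chi> u = \<chi>' u" "few_bad_edges k E B \<chi> v" for v \<chi> \<chi>'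
      using few_bad_edges_cong[of v E \<chi> \<chi>'] that by blast
    show "\<exists>\<chi>\<in>Pi V L. \<forall>v\<in>F. few_bad_edges k E B \<chi> v" if "finite F" "F \<subseteq> ?S" for F
      using assms(1) card_L that unfolding finitely_majority_choosable_def by blast
  qed (use \<open>E \<subseteq> V \<times> V\<close> in auto)
  then show thesis
    using that by blast
qed

lemma majority_correspondence_colouringI:
  assumes "0 < k" and \<chi>: "\<chi> \<in> Pi V L"
    and few: "\<And>v. v \<in> V \<Longrightarrow> finite (E `` {v}) \<Longrightarrow> few_bad_edges k E B \<chi> v"
    and inf: "\<And>v. v \<in> V \<Longrightarrow> infinite (E `` {v}) \<Longrightarrow> infinite {u \<in> E `` {v}. (\<chi> v, \<chi> u) \<notin> B v u}"
  shows "majority_correspondence_colouring k V E L B \<chi>"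
proof -
  have "{e \<in> relevant_edges E v. \<not> bad B \<chi> e} = Pair v ` {u \<in> E `` {v}. (\<chi> v, \<chi> u) \<notin> B v u}" for v
    by (auto simp: relevant_edges_def bad_def)
  then have "infinite {e \<in> relevant_edges E v. \<not> bad B \<chi> e}"
    if "v \<in> V" "infinite (relevant_edges E v)" for v
    using inf that by (simp add: finite_relevant_edges_iff finite_image_iff inj_on_def)
  then show ?thesis
    using \<chi> few few_bad_edges_iff_proportion[OF \<open>0 < k\<close>, of E B \<chi>]
    by (auto simp: majority_correspondence_colouring_def finite_relevant_edges_iff)
qed

lemma exists_majority_correspondence_colouring:
  assumes "E \<subseteq> V \<times> V" "countable V" and L: "\<And>v. v \<in> V \<Longrightarrow> finite (L v) \<and> k < card (L v)"
    and corr: "edgewise_correspondence E L B" and "finitely_majority_choosable k V E B" "0 < k"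
  shows "\<exists>\<chi>. majority_correspondence_colouring k V E L B \<chi>"
proof -
  have "countable (L v)" if "v \<in> V" for v
    using L[OF that] by (simp add: countable_finite)
  then obtain d where d: "\<And>v c. v \<in> V \<Longrightarrow> infinite (E `` {v}) \<Longrightarrow> c \<in> L v \<Longrightarrow>
      infinite {u \<in> E `` {v}. \<forall>c'\<in>L u - {d u}. (c, c') \<notin> B v u}"
    using exists_deletion_serving_infinite_degrees[OF \<open>countable V\<close> _ corr] by blast
  have "k \<le> card (L v - {d v})" if "v \<in> V" for v
    using L[OF that] by (auto simp: card_Diff_singleton_if)
  then obtain \<chi> where \<chi>: "\<chi> \<in> (\<Pi> v\<in>V. L v - {d v})"
    "\<And>v. v \<in> V \<Longrightarrow> finite (E `` {v}) \<Longrightarrow> few_bad_edges k E B \<chi> v"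
    using finitely_majority_choosable_imp_choosable[of k V E B "\<lambda>v. L v - {d v}"] assms by blast
  have "majority_correspondence_colouring k V E L B \<chi>"
  proof (rule majority_correspondence_colouringI)
    show "infinite {u \<in> E `` {v}. (\<chi> v, \<chi> u) \<notin> B v u}" if "v \<in> V" "infinite (E `` {v})" for v
    proof -
      have "infinite {u \<in> E `` {v}. \<forall>c'\<in>L u - {d u}. (\<chi> v, c') \<notin> B v u}"
        using d[OF that] \<chi>(1) that(1) by blast
      moreover have "{u \<in> E `` {v}. \<forall>c'\<in>L u - {d u}. (\<chi> v, c') \<notin> B v u}
          \<subseteq> {u \<in> E `` {v}. (\<chi> v, \<chi> u) \<notin> B v u}"
        using \<chi>(1) \<open>E \<subseteq> V \<times> V\<close> by blast
      ultimately show ?thesis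
        using finite_subset by blast
    qed
  qed (use \<open>0 < k\<close> \<chi> in auto)
  then show ?thesis
    by blast
qed

theorem theorem11:
  fixes k :: nat
  assumes "k \<ge> 2"
  shows "(\<forall>(V :: 'v set) E. graph V E \<and> countable V \<longrightarrow>
            graph_majority_correspondence_colourable TYPE('c) k (k + 1) V E) \<and>
         (\<forall>(V :: 'v set) E. digraph V E \<and> acyclic E \<and> countable V \<longrightarrow>
            digraph_majority_correspondence_colourable TYPE('c) k (k + 1) V E)"
proof -
  have "0 < k"
    using assms by simp
  have colouring: "\<exists>\<chi>. majority_correspondence_colouring k V E L B \<chi>"
    if "digraph_system (k + 1) V E L B" "E \<subseteq> V \<times> V" "countable V"
      and "edgewise_correspondence E L B \<Longrightarrow> finitely_majority_choosable k V E B"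
    for V :: "'v set" and E and L :: "'v \<Rightarrow> 'c set" and B
    using that \<open>0 < k\<close>
    by (intro exists_majority_correspondence_colouring)
      (auto simp: digraph_system_def edgewise_correspondence_def)
  show ?thesis
  proof (intro conjI allI impI)
    fix V :: "'v set" and E assume "graph V E \<and> countable V"
    then show "graph_majority_correspondence_colourable TYPE('c) k (k + 1) V E"
      unfolding graph_majority_correspondence_colourable_def
      using graph_finitely_majority_choosable[OF _ _ _ _ \<open>0 < k\<close>]
      by (auto simp: graph_def graph_system_def intro!: colouring)
  next
    fix V :: "'v set" and E assume "digraph V E \<and> acyclic E \<and> countable V"
    then show "digraph_majority_correspondence_colourable TYPE('c) k (k + 1) V E"
      unfolding digraph_majority_correspondence_colourable_def
      using acyclic_finitely_majority_choosable[OF _ _ \<open>0 < k\<close>]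
      by (auto simp: digraph_def intro!: colouring)
  qed
qed

end
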